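(* Let $a\ge b>0$, let $k'=\frac{ab}{2(a+b)^2}$, and let $s'=\sqrt{\frac{2b^2+ab}{2a^2+ab}}$. Let $\mathcal{K}$ be the circumcircle family with parameters $a,b$, and let $\mathcal{X}$ be the excentral family affinely related to it, i.e., the image of $\mathcal{K}$ under the scaling $(x,y)\mapsto(s'x,y)$. Then the locus $\Delta'$ of cosine triples over the triangles of $\mathcal{K}$ (or, equally, over those of $\mathcal{X}$) is the intersection of a sphere with a Titeica surface, namely $$\Delta':\quad x^2+y^2+z^2+2k'-1=0,\qquad xyz-k'=0.$$
   Context: Circumcircle family with parameters $a,b$: the set of all (nondegenerate) triangles inscribed in the circle of radius $R=a+b$ centered at the origin whose three sides are tangent to the concentric ellipse $x^2/a^2+y^2/b^2=1$ (the caustic). (By Poncelet's porism, with this value of $R$, every point of the circle is a vertex of exactly one such triangle.) The product of the cosines of the internal angles is $k'$ for every triangle of this family. Confocal family: for an ellipse and a confocal ellipse inside it such that triangles inscribed in the outer one and circumscribed about the inner one exist, the set of all such triangles. Excentral family: the set of excentral triangles of the triangles in a confocal family, where the excentral triangle of a triangle $T$ is the triangle whose vertices are the excenters of $T$ (its sides pass through the vertices of $T$ perpendicularly to the internal angle bisectors). The image of the circumcircle family under $(x,y)\mapsto(s'x,y)$ with the stated $s'$ is an excentral family. Cosine triple of a triangle: $(x,y,z)=(\cos\theta_1,\cos\theta_2,\cos\theta_3)\in\mathbb{R}^3$, where $\theta_1,\theta_2,\theta_3$ are the internal angles at its vertices $P_1,P_2,P_3$. The locus of cosine triples of a family is the curve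 swept by these triples over the triangles of the family. A Titeica surface is a surface $xyz=\zeta$ with $\zeta$ constant.
   Formalization: The locus is shown to equal the part of Δ' with x, y, z > 0; the literal equality with all of Δ' fails, since for a=b=1 the point (-1/2,-1/2,1/2) satisfies both equations but is not the cosine triple of any triangle. *)

theory Defs
  imports "HOL-Analysis.Analysis"
begin

type_synonym point = "real \<times> real"

text \<open>Triangles carry a labelling of their vertices; each geometric triangle of a family
  occurs with all six labellings.\<close>

type_synonym triangle = "point \<times> point \<times> point"

definition ellipse :: "real \<Rightarrow> real \<Rightarrow> point set" where
  "ellipse a b = {(x, y). x^2 / a^2 + y^2 / b^2 = 1}"

text \<open>The line through \<open>T\<close> orthogonal to \<open>(u / a^2, v / b^2)\<close>, which is half the gradient
  of \<open>x^2 / a^2 + y^2 / b^2\<close> at \<open>T = (u, v)\<close>.\<close>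

definition ellipse_tangent_line :: "real \<Rightarrow> real \<Rightarrow> point \<Rightarrow> point set" where
  "ellipse_tangent_line a b T = {X. (X - T) \<bullet> (fst T / a^2, snd T / b^2) = 0}"

definition side_tangent_to_ellipse :: "real \<Rightarrow> real \<Rightarrow> point \<Rightarrow> point \<Rightarrow> bool" where
  "side_tangent_to_ellipse a b P Q \<longleftrightarrow>
     (\<exists>T \<in> ellipse a b. T \<in> closed_segment P Q \<and>
        affine hull {P, Q} = ellipse_tangent_line a b T)"

definition circumcircle_family :: "real \<Rightarrow> real \<Rightarrow> triangle set" where
  "circumcircle_family a b =
     {(P, Q, R). \<not> collinear {P, Q, R} \<and> {P, Q, R} \<subseteq> sphere 0 (a + b) \<and>
        side_tangent_to_ellipse a b P Q \<and>
        side_tangent_to_ellipse a b Q R \<and>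
        side_tangent_to_ellipse a b R P}"

definition map_triangle :: "(point \<Rightarrow> point) \<Rightarrow> triangle \<Rightarrow> triangle" where
  "map_triangle f = (\<lambda>(P, Q, R). (f P, f Q, f R))"

definition internal_angle :: "point \<Rightarrow> point \<Rightarrow> point \<Rightarrow> real" where
  \<comment> \<open>the angle at the middle argument \<open>P\<close>\<close>
  "internal_angle Q P R = arccos (((Q - P) \<bullet> (R - P)) / (norm (Q - P) * norm (R - P)))"

definition cosine_triple :: "triangle \<Rightarrow> real \<times> real \<times> real" where
  "cosine_triple = (\<lambda>(P, Q, R).
     (cos (internal_angle R P Q), cos (internal_angle P Q R), cos (internal_angle Q R P)))"

definition cosine_locus :: "triangle set \<Rightarrow> (real \<times> real \<times> real) set" where
  "cosine_locus F = cosine_triple ` F"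

definition titeica_surface :: "real \<Rightarrow> (real \<times> real \<times> real) set" where
  "titeica_surface \<zeta> = {(x, y, z). x * y * z = \<zeta>}"

text \<open>A triangle has at most one non-acute angle, so a cosine triple with positive product lies
  here, whereas surfaces such as \<open>x * y * z = \<zeta>\<close> and spheres about the origin are also
  invariant under changing two signs.\<close>

definition positive_octant :: "(real \<times> real \<times> real) set" where
  "positive_octant = {(x, y, z). 0 < x \<and> 0 < y \<and> 0 < z}"

end

theory Submission
  imports Defs
begin

text \<open>Divide the vertices of a triangle of the circumcircle family by the circumradius \<open>a + b\<close>. A chord
  \<open>p q\<close> of the unit circle then comes from a tangent of the caustic iff
  \<open>fst p * fst q / a + snd p * snd q / b = - 1 / (a + b)\<close>, that is, iff \<open>p\<close> and \<open>q\<close> are conjugate with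
  respect to a conic. So the triangles of the family are the triangles inscribed in the unit circle that
  are self-polar for this conic (\<open>circumcircle_family_self_polar\<close>).

  The cosines of the angles of any triangle satisfy \<open>x\<^sup>2 + y\<^sup>2 + z\<^sup>2 + 2 * x * y * z = 1\<close>
  (\<open>triangle_cosine_identity\<close>), and at most one of them fails to be positive. Hence the triple lies on
  the curve, in the positive octant, iff \<open>x * y * z = k'\<close>, and only this product has to be computed.

  For the circumcircle family, view the vertices as complex numbers \<open>u, v, w\<close>. Self-polarity amounts to
  \<open>u * v + v * w + w * u = - (a - b) / (a + b)\<close>. So the orthocentre \<open>u + v + w\<close> has constant distance from the
  centre, and this distance determines the product of the cosines (\<open>self_polar_cosine_product\<close>).

  For the excentral family, the sides of the stretched triangle have normals that depend linearly on the
  opposite vertices. The product of the cosines becomes a quotient of two Gram determinants of the vectors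
  \<open>(fst p, snd p, 1)\<close>: for one quadratic form these vectors are orthogonal, for the other they are
  isotropic, and the area of the triangle cancels (\<open>stretched_self_polar_cosine_product\<close>).

  Conversely, a triple on the curve in the positive octant consists of the cosines of a triangle. Write its unit
  outward normals as complex numbers. The sum of their squares has absolute value \<open>\<bar>a - b\<bar> / (a + b)\<close>, so
  after a rotation it is \<open>(a - b) / (a + b)\<close> (\<open>exists_side_normals\<close>). From these normals one writes down
  explicitly a triangle of the circumcircle family with these angles, and another one whose stretched image has
  them (\<open>self_polar_with_cosines\<close>, \<open>self_polar_with_stretched_cosines\<close>).\<close>

section \<open>Cosines of the angles of a triangle\<close>

lemma unit_point: "p \<in> sphere 0 1 \<longleftrightarrow> (fst p)\<^sup>2 + (snd p)\<^sup>2 = (1::real)" for p :: point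
  by (cases p) (simp add: norm_Pair)

lemma inner_point: "p \<bullet> q = fst p * fst q + snd p * snd q" for p q :: point
  by (cases p; cases q) simp

definition signed_area2 :: "point \<Rightarrow> point \<Rightarrow> point \<Rightarrow> real" where
  "signed_area2 p q r = (fst q - fst p) * (snd r - snd p) - (snd q - snd p) * (fst r - fst p)"

text \<open>The left-hand side is the Gram determinant of the vectors \<open>(fst p, snd p, 1)\<close>, \<open>(fst q, snd q, 1)\<close>,
  \<open>(fst r, snd r, 1)\<close> with respect to the diagonal form with entries \<open>\<alpha>, \<beta>, \<gamma>\<close>. It is the product
  of the determinant of the form with the squared determinant of the three vectors.\<close>

lemma gram_det3:
  fixes \<alpha> \<beta> \<gamma> :: real
  defines "g \<equiv> \<lambda>p q :: point. \<alpha> * fst p * fst q + \<beta> * snd p * snd q + \<gamma>"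
  shows "g p p * g q q * g r r + 2 * g p q * g q r * g r p
       - g p p * (g q r)\<^sup>2 - g q q * (g r p)\<^sup>2 - g r r * (g p q)\<^sup>2
       = \<alpha> * \<beta> * \<gamma> * (signed_area2 p q r)\<^sup>2"
  unfolding g_def signed_area2_def by algebra

lemma gram_det2:
  "(p \<bullet> p) * (q \<bullet> q) * (r \<bullet> r) + 2 * (p \<bullet> q) * (q \<bullet> r) * (r \<bullet> p)
   - (p \<bullet> p) * (q \<bullet> r)\<^sup>2 - (q \<bullet> q) * (r \<bullet> p)\<^sup>2 - (r \<bullet> r) * (p \<bullet> q)\<^sup>2 = 0" for p q r :: point
  using gram_det3[of 1 p 1 0 q r] by (simp add: inner_point)

lemma orthogonal_eq_scaled_rotation:
  fixes n u :: point
  assumes "n \<bullet> u = 0" "n \<noteq> 0"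
  shows "\<exists>l. u = l *\<^sub>R (- snd n, fst n)"
proof
  have "(fst n)\<^sup>2 + (snd n)\<^sup>2 \<noteq> 0" using assms(2) by (simp add: prod_eq_iff sum_power2_eq_zero_iff)
  then show "u = ((fst n * snd u - snd n * fst u) / ((fst n)\<^sup>2 + (snd n)\<^sup>2)) *\<^sub>R (- snd n, fst n)"
    using assms(1)
    by (simp add: prod_eq_iff inner_point field_simps) algebra
qed

text \<open>By the Cauchy--Schwarz inequality the argument of \<open>arccos\<close> lies in its domain. This includes
  degenerate angles, where the quotient is zero.\<close>

lemma cos_internal_angle:
  "cos (internal_angle Q P R) = ((Q - P) \<bullet> (R - P)) / (norm (Q - P) * norm (R - P))"
proof -
  have "\<bar>((Q - P) \<bullet> (R - P)) / (norm (Q - P) * norm (R - P))\<bar> \<le> 1"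
    using Cauchy_Schwarz_ineq2[of "Q - P" "R - P"] by (auto simp: abs_mult divide_le_eq_1)
  then show ?thesis unfolding internal_angle_def by (intro cos_arccos; linarith)
qed

text \<open>Two sides enclose the angle supplementary to that of their outward normals. The sign condition
  says that both normals point outward or both point inward.\<close>

lemma cos_internal_angle_normals:
  assumes n: "n \<bullet> (Q - P) = 0" and m: "m \<bullet> (R - P) = 0"
    and pos: "0 < (n \<bullet> (R - P)) * (m \<bullet> (Q - P))"
  shows "cos (internal_angle Q P R) = - (n \<bullet> m) / (norm n * norm m)"
proof -
  define J :: "point \<Rightarrow> point" where "J = (\<lambda>n. (- snd n, fst n))"
  have nz: "n \<noteq> 0" "m \<noteq> 0" using pos by auto
  obtain l where l: "Q - P = l *\<^sub>R J n" using orthogonal_eq_scaled_rotation[OF n nz(1)] unfolding J_def by blast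
  obtain k where k: "R - P = k *\<^sub>R J m" using orthogonal_eq_scaled_rotation[OF m nz(2)] unfolding J_def by blast
  have "(n \<bullet> (R - P)) * (m \<bullet> (Q - P)) = - (l * k) * (n \<bullet> J m)\<^sup>2"
    unfolding l k by (simp add: J_def inner_point algebra_simps power2_eq_square)
  (* pos holds exactly because Q - P and R - P are multiples of J n and J m of opposite signs *)
  with pos have lk: "l * k < 0" by (simp add: mult_less_0_iff zero_less_mult_iff)
  have "norm (J n) = norm n" "norm (J m) = norm m" "J n \<bullet> J m = n \<bullet> m"
    unfolding J_def by (simp_all add: norm_prod_def inner_point add.commute)
  then have "cos (internal_angle Q P R) = (l * k * (n \<bullet> m)) / (\<bar>l * k\<bar> * (norm n * norm m))"
    unfolding cos_internal_angle l k by (simp add: abs_mult mult_ac)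
  also have "\<dots> = - (n \<bullet> m) / (norm n * norm m)"
    using lk by (simp only: abs_of_neg) (simp only: minus_mult_left[symmetric] divide_minus_right mult_divide_mult_cancel_left less_imp_neq minus_divide_left[symmetric] simp_thms)
  finally show ?thesis .
qed

text \<open>Up to sign the cosines are the inner products of the unit vectors along the three sides. These
  are three vectors in the plane, so their Gram determinant vanishes.\<close>

lemma triangle_cosine_identity:
  assumes "P \<noteq> Q" "Q \<noteq> R" "R \<noteq> P" and "cosine_triple (P, Q, R) = (x, y, z)"
  shows "x\<^sup>2 + y\<^sup>2 + z\<^sup>2 + 2 * (x * y * z) = 1"
proof -
  define d e f where "d = sgn (Q - R)" and "e = sgn (R - P)" and "f = sgn (P - Q)"
  have dot: "sgn (u - v) \<bullet> sgn (v - w) = - cos (internal_angle u v w)" for u v w :: point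
  proof -
    have "sgn (v - w) = - sgn (w - v)" by (metis minus_diff_eq sgn_minus)
    then show ?thesis
      unfolding cos_internal_angle by (simp add: sgn_div_norm divide_inverse mult_ac)
  qed
  have xyz: "x = - (e \<bullet> f)" "y = - (f \<bullet> d)" "z = - (d \<bullet> e)"
    using assms(4) unfolding d_def e_def f_def dot cosine_triple_def by simp_all
  have "d \<bullet> d = 1" "e \<bullet> e = 1" "f \<bullet> f = 1"
    using assms(1-3) unfolding d_def e_def f_def by (simp_all add: norm_sgn flip: norm_eq_1)
  then show ?thesis unfolding xyz using gram_det2[of d e f]
    by (simp add: algebra_simps)
qed

lemma obtuse_at_most_once:
  assumes "P \<noteq> Q" and "(Q - P) \<bullet> (R - P) \<le> 0"
  shows "(P - Q) \<bullet> (R - Q) > 0"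
proof -
  have "(Q - P) \<bullet> (R - P) + (P - Q) \<bullet> (R - Q) = (Q - P) \<bullet> (Q - P)"
    by (simp add: algebra_simps inner_commute)
  then show ?thesis using assms by (smt (verit) inner_gt_zero_iff eq_iff_diff_eq_0)
qed

text \<open>Two angles are never both non-acute, so an odd number of positive cosines means three.\<close>

lemma acute_if_cosine_product_pos:
  assumes "P \<noteq> Q" "Q \<noteq> R" "R \<noteq> P" and "cosine_triple (P, Q, R) = (x, y, z)" and "x * y * z > 0"
  shows "x > 0 \<and> y > 0 \<and> z > 0"
proof -
  have xyz: "x = cos (internal_angle R P Q)" "y = cos (internal_angle P Q R)"
    "z = cos (internal_angle Q R P)"
    using assms(4) by (simp_all add: cosine_triple_def)
  have acute: "cos (internal_angle u v w) > 0 \<or> cos (internal_angle v w u) > 0"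
    if "u \<noteq> v" "v \<noteq> w" "w \<noteq> u" for u v w :: point
  proof -
    have "(w - v) \<bullet> (u - v) > 0 \<or> (v - w) \<bullet> (u - w) > 0"
      using obtuse_at_most_once[of v w u] that by force
    then show ?thesis
    proof
      assume "(w - v) \<bullet> (u - v) > 0"
      then have "cos (internal_angle u v w) > 0"
        unfolding cos_internal_angle using that by (simp add: inner_commute)
      then show ?thesis ..
    next
      assume "(v - w) \<bullet> (u - w) > 0"
      then have "cos (internal_angle v w u) > 0"
        unfolding cos_internal_angle using that by simp
      then show ?thesis ..
    qed
  qed
  have or: "x > 0 \<or> y > 0" "y > 0 \<or> z > 0" "z > 0 \<or> x > 0"
    unfolding xyz by (intro acute; use assms(1-3) in blast)+
  have pos: "0 < u" if "0 < u * (v * w)" "u > 0 \<or> v > 0" "w > 0 \<or> u > 0" for u v w :: real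
  proof (rule ccontr)
    assume "\<not> 0 < u"
    then have "u * (v * w) \<le> 0"
      using that(2,3) by (intro mult_nonpos_nonneg) auto
    then show False using that(1) by simp
  qed
  have perm: "0 < x * (y * z)" "0 < y * (z * x)" "0 < z * (x * y)"
    using assms(5) by (simp_all only: mult_ac)
  show ?thesis
    using pos[of x y z] pos[of y z x] pos[of z x y] or perm by blast
qed

text \<open>By the identity of the three cosines, a value of their product already fixes the sum of their
  squares, and a positive value fixes their signs. So membership in the locus is a statement about
  the product alone.\<close>

lemma cosine_product_characterises:
  assumes "P \<noteq> Q" "Q \<noteq> R" "R \<noteq> P" and "cosine_triple (P, Q, R) = (x, y, z)"
    and "x * y * z = k" "k > 0"
  shows "x\<^sup>2 + y\<^sup>2 + z\<^sup>2 + 2 * k - 1 = 0 \<and> x * y * z - k = 0 \<and> 0 < x \<and> 0 < y \<and> 0 < z"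
  using triangle_cosine_identity[OF assms(1-4)] acute_if_cosine_product_pos[OF assms(1-4)] assms(5,6)
  by simp

text \<open>This is the classical formula \<open>OH\<^sup>2 = R\<^sup>2 (1 - 8 cos A cos B cos C)\<close>: the orthocentre of a triangle
  inscribed in a circle about the origin is the sum of its vertices.\<close>

lemma unit_triangle_cosine_product:
  assumes "P \<noteq> Q" "Q \<noteq> R" "R \<noteq> P" and "cosine_triple (P, Q, R) = (x, y, z)"
    and "{P, Q, R} \<subseteq> sphere 0 1"
  shows "8 * (x * y * z) = 1 - (norm (P + Q + R))\<^sup>2"
proof -
  define g h k where "g = P \<bullet> Q" and "h = Q \<bullet> R" and "k = R \<bullet> P"
  have u: "P \<bullet> P = 1" "Q \<bullet> Q = 1" "R \<bullet> R = 1"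
    using assms(5) by (auto simp: norm_eq_1)
  have n: "(norm (P - Q))\<^sup>2 = 2 - 2 * g" "(norm (Q - R))\<^sup>2 = 2 - 2 * h" "(norm (R - P))\<^sup>2 = 2 - 2 * k"
    unfolding power2_norm_eq_inner g_def h_def k_def using u
    by (simp_all add: inner_diff_left inner_diff_right inner_commute[of Q P] inner_commute[of R Q] inner_commute[of P R])
  have dots: "(R - P) \<bullet> (Q - P) = 1 + h - g - k" "(P - Q) \<bullet> (R - Q) = 1 + k - g - h"
    "(Q - R) \<bullet> (P - R) = 1 + g - h - k"
    unfolding g_def h_def k_def using u
    by (simp_all add: inner_diff_left inner_diff_right inner_commute[of Q P] inner_commute[of R Q] inner_commute[of P R])
  have nz: "2 - 2 * g \<noteq> 0" "2 - 2 * h \<noteq> 0" "2 - 2 * k \<noteq> 0"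
    using assms(1-3) by (simp_all flip: n)
  have gram: "1 + 2 * g * h * k = g\<^sup>2 + h\<^sup>2 + k\<^sup>2"
    using gram_det2[of P Q R] unfolding u g_def h_def k_def by simp
  have "x = (R - P) \<bullet> (Q - P) / (norm (R - P) * norm (P - Q))"
    "y = (P - Q) \<bullet> (R - Q) / (norm (P - Q) * norm (Q - R))"
    "z = (Q - R) \<bullet> (P - R) / (norm (Q - R) * norm (R - P))"
    using assms(4) unfolding cosine_triple_def
    by (simp_all add: cos_internal_angle norm_minus_commute[of Q P] norm_minus_commute[of R Q]
        norm_minus_commute[of P R])
  then have "x * y * z = (R - P) \<bullet> (Q - P) * ((P - Q) \<bullet> (R - Q)) * ((Q - R) \<bullet> (P - R))
      / ((norm (P - Q))\<^sup>2 * (norm (Q - R))\<^sup>2 * (norm (R - P))\<^sup>2)"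
    by (simp only: times_divide_times_eq power2_eq_square mult_ac)
  also have "\<dots> = (1 + h - g - k) * (1 + k - g - h) * (1 + g - h - k)
      / ((2 - 2 * g) * (2 - 2 * h) * (2 - 2 * k))"
    unfolding n dots ..
  (* the numerator is a multiple of the denominator modulo the Gram relation *)
  also have "\<dots> = - (1 + g + h + k) / 4"
  proof -
    have "4 * ((1 + h - g - k) * (1 + k - g - h) * (1 + g - h - k))
        + (1 + g + h + k) * ((2 - 2 * g) * (2 - 2 * h) * (2 - 2 * k))
      = 4 * (3 - g - h - k) * (1 + 2 * g * h * k - (g\<^sup>2 + h\<^sup>2 + k\<^sup>2))"
      by (simp add: algebra_simps power2_eq_square)
    also have "\<dots> = 0"
      unfolding gram by simp
    finally have *: "4 * ((1 + h - g - k) * (1 + k - g - h) * (1 + g - h - k))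
      = - (1 + g + h + k) * ((2 - 2 * g) * (2 - 2 * h) * (2 - 2 * k))"
      by (simp only: mult_minus_left add_eq_0_iff2)
    have "(N :: real) / D = - s / 4" if "4 * N = - s * D" "D \<noteq> 0" for N D s
      using that by (simp add: field_simps)
    from this[OF *] nz show ?thesis by simp
  qed
  finally have "x * y * z = - (1 + g + h + k) / 4" .
  moreover have "(norm (P + Q + R))\<^sup>2 = 3 + 2 * (g + h + k)"
    unfolding power2_norm_eq_inner g_def h_def k_def using u
    by (simp add: inner_add_left inner_add_right inner_commute[of Q P] inner_commute[of R Q] inner_commute[of P R])
  ultimately show ?thesis by simp
qed

lemma internal_angle_scaleR:
  assumes "c > 0"
  shows "internal_angle (c *\<^sub>R Q) (c *\<^sub>R P) (c *\<^sub>R R) = internal_angle Q P R"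
  using assms unfolding internal_angle_def scaleR_diff_right[symmetric]
  by simp

lemma cosine_triple_scaleR:
  assumes "c > 0"
  shows "cosine_triple (c *\<^sub>R P, c *\<^sub>R Q, c *\<^sub>R R) = cosine_triple (P, Q, R)"
  unfolding cosine_triple_def by (simp add: internal_angle_scaleR[OF assms])

section \<open>Self-polar triangles in the unit circle\<close>

text \<open>Conjugacy with respect to the conic \<open>x\<^sup>2 / a + y\<^sup>2 / b + 1 / (a + b) = 0\<close>, which has no real points. It
  is meant for points of the unit circle, that is, for vertices divided by the circumradius \<open>a + b\<close>.\<close>

definition conjugate_points :: "real \<Rightarrow> real \<Rightarrow> point \<Rightarrow> point \<Rightarrow> bool" where
  "conjugate_points a b p q \<longleftrightarrow> fst p * fst q / a + snd p * snd q / b = - 1 / (a + b)"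

definition self_polar :: "real \<Rightarrow> real \<Rightarrow> point \<Rightarrow> point \<Rightarrow> point \<Rightarrow> bool" where
  "self_polar a b p q r \<longleftrightarrow> {p, q, r} \<subseteq> sphere 0 1 \<and>
     conjugate_points a b p q \<and> conjugate_points a b q r \<and> conjugate_points a b r p"

lemma self_polar_rotate: "self_polar a b p q r \<Longrightarrow> self_polar a b q r p"
  unfolding self_polar_def by auto

lemma conjugate_weighted:
  assumes "a > 0" "b > 0" "conjugate_points a b p q"
  shows "(a + b) / a * fst p * fst q + (a + b) / b * snd p * snd q + 1 = 0"
proof -
  have "(a + b) * (fst p * fst q / a + snd p * snd q / b) = -1"
    using assms unfolding conjugate_points_def by simp
  then show ?thesis by (simp add: algebra_simps)
qed

text \<open>With the weight \<open>(a + b) / a, (a + b) / b, 1\<close> the three vertices, seen as vectors in space, are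
  orthogonal, so their Gram determinant is the product of the squared lengths. With the Lorentz
  weight \<open>1, 1, -1\<close> they are isotropic, so only the off-diagonal entries remain. Comparing
  the two eliminates the area.\<close>

lemma self_polar_gram:
  assumes ab: "a > 0" "b > 0" and sp: "self_polar a b p q r"
  defines "w \<equiv> \<lambda>p :: point. (a + b) / a * (fst p)\<^sup>2 + (a + b) / b * (snd p)\<^sup>2 + 1"
  shows "w p * w q * w r = (a + b)\<^sup>2 / (a * b) * (signed_area2 p q r)\<^sup>2"
    and "2 * (1 - p \<bullet> q) * (1 - q \<bullet> r) * (1 - r \<bullet> p) = (signed_area2 p q r)\<^sup>2"
proof -
  have 0: "(a + b) / a * fst p * fst q + (a + b) / b * snd p * snd q + 1 = 0"
    "(a + b) / a * fst q * fst r + (a + b) / b * snd q * snd r + 1 = 0"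
    "(a + b) / a * fst r * fst p + (a + b) / b * snd r * snd p + 1 = 0"
    using sp conjugate_weighted[OF ab] unfolding self_polar_def by blast+
  show "w p * w q * w r = (a + b)\<^sup>2 / (a * b) * (signed_area2 p q r)\<^sup>2"
    using gram_det3[of "(a + b) / a" p "(a + b) / b" 1 q r] unfolding 0 w_def
    by (simp add: power2_eq_square mult.assoc)
  have u: "fst p * fst p + snd p * snd p = 1" "fst q * fst q + snd q * snd q = 1"
    "fst r * fst r + snd r * snd r = 1"
    using sp unfolding self_polar_def insert_subset unit_point power2_eq_square by blast+
  show "2 * (1 - p \<bullet> q) * (1 - q \<bullet> r) * (1 - r \<bullet> p) = (signed_area2 p q r)\<^sup>2"
    using gram_det3[of 1 p 1 "-1" q r] u
    by (simp add: inner_point algebra_simps)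
qed

text \<open>The weighted Gram determinant is a product of positive squared lengths.\<close>

lemma self_polar_area_nonzero:
  assumes ab: "a > 0" "b > 0" and sp: "self_polar a b p q r"
  shows "signed_area2 p q r \<noteq> 0"
proof
  assume "signed_area2 p q r = 0"
  moreover have "(a + b) / a * (fst p)\<^sup>2 + (a + b) / b * (snd p)\<^sup>2 + 1 > 0" for p :: point
    using ab by (intro add_nonneg_pos add_nonneg_nonneg) auto
  then have "((a + b) / a * (fst p)\<^sup>2 + (a + b) / b * (snd p)\<^sup>2 + 1)
      * ((a + b) / a * (fst q)\<^sup>2 + (a + b) / b * (snd q)\<^sup>2 + 1)
      * ((a + b) / a * (fst r)\<^sup>2 + (a + b) / b * (snd r)\<^sup>2 + 1) > 0"
    by (meson mult_pos_pos)
  ultimately show False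
    unfolding self_polar_gram(1)[OF ab sp] by simp
qed

lemma self_polar_distinct:
  assumes ab: "a > 0" "b > 0" and sp: "self_polar a b p q r"
  shows "p \<noteq> q" "q \<noteq> r" "r \<noteq> p"
  using self_polar_area_nonzero[OF assms] unfolding signed_area2_def by auto

section \<open>Chords tangent to the caustic\<close>

lemma line_through_two_points:
  fixes n P Q X :: point
  assumes "n \<bullet> (Q - P) = 0" "n \<bullet> (X - P) = 0" "n \<noteq> 0" "P \<noteq> Q"
  obtains t where "X = P + t *\<^sub>R (Q - P)"
proof -
  obtain k where k: "Q - P = k *\<^sub>R (- snd n, fst n)"
    using orthogonal_eq_scaled_rotation assms(1,3) by blast
  obtain l where l: "X - P = l *\<^sub>R (- snd n, fst n)"
    using orthogonal_eq_scaled_rotation assms(2,3) by blast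
  have "k \<noteq> 0" using k assms(4) by (metis eq_iff_diff_eq_0 scaleR_zero_left)
  then have "X - P = (l / k) *\<^sub>R (Q - P)" unfolding k l by simp
  then have "X = P + (l / k) *\<^sub>R (Q - P)" by (metis add_diff_cancel_left' diff_add_cancel add.commute)
  then show thesis by (rule that)
qed

lemma collinear_imp_signed_area2_0:
  assumes "collinear {P, Q, R}"
  shows "signed_area2 P Q R = 0"
proof -
  obtain u where "\<forall>x\<in>{P, Q, R}. \<forall>y\<in>{P, Q, R}. \<exists>c. x - y = c *\<^sub>R u"
    using assms unfolding collinear_def by blast
  then obtain c d where "Q - P = c *\<^sub>R u" "R - P = d *\<^sub>R u" by blast
  then have "fst Q - fst P = c * fst u" "snd Q - snd P = c * snd u"
    "fst R - fst P = d * fst u" "snd R - snd P = d * snd u"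
    by (simp_all add: prod_eq_iff)
  then show ?thesis unfolding signed_area2_def by simp
qed

text \<open>A line touches the caustic iff its coefficients satisfy the dual equation of the ellipse. The
  coefficients of a chord of the circle depend on the products \<open>p1 * q1\<close> and \<open>p2 * q2\<close> of the coordinates of its
  end points, and in terms of these, after clearing denominators, the dual equation is linear.\<close>

lemma tangent_chord_imp_conjugate:
  fixes p q T :: point
  assumes ab: "a > 0" "b > 0"
    and u: "p \<in> sphere 0 1" "q \<in> sphere 0 1" and "p \<noteq> q"
    and T: "T \<in> ellipse a b"
    and l: "(a + b) *\<^sub>R p \<in> ellipse_tangent_line a b T" "(a + b) *\<^sub>R q \<in> ellipse_tangent_line a b T"
  shows "conjugate_points a b p q"
proof -
  define \<rho> where "\<rho> = a + b"
  have \<rho>: "\<rho> > 0" using ab unfolding \<rho>_def by simp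
  obtain p1 p2 q1 q2 t1 t2 where c: "p = (p1, p2)" "q = (q1, q2)" "T = (t1, t2)"
    by (metis prod.exhaust)
  define \<alpha> \<beta> where "\<alpha> = \<rho> * t1 / a\<^sup>2" and "\<beta> = \<rho> * t2 / b\<^sup>2"
  have p: "p1\<^sup>2 + p2\<^sup>2 = 1" and q: "q1\<^sup>2 + q2\<^sup>2 = 1" using u unfolding unit_point c by simp_all
  have el: "t1\<^sup>2 / a\<^sup>2 + t2\<^sup>2 / b\<^sup>2 = 1" using T unfolding ellipse_def c by simp
  have lin: "\<alpha> * x1 + \<beta> * x2 = 1" if "\<rho> *\<^sub>R (x1, x2) \<in> ellipse_tangent_line a b T" for x1 x2
  proof -
    have "(\<rho> * x1 - t1) * (t1 / a\<^sup>2) + (\<rho> * x2 - t2) * (t2 / b\<^sup>2) = 0"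
      using that unfolding ellipse_tangent_line_def c by simp
    then have "\<alpha> * x1 + \<beta> * x2 = t1\<^sup>2 / a\<^sup>2 + t2\<^sup>2 / b\<^sup>2"
      unfolding \<alpha>_def \<beta>_def by (simp add: diff_divide_distrib algebra_simps power2_eq_square)
    then show ?thesis using el by simp
  qed
  have lp: "\<alpha> * p1 + \<beta> * p2 = 1" and lq: "\<alpha> * q1 + \<beta> * q2 = 1"
    using lin l unfolding c \<rho>_def by simp_all
  have nf: "a\<^sup>2 * \<alpha>\<^sup>2 + b\<^sup>2 * \<beta>\<^sup>2 = \<rho>\<^sup>2"
  proof -
    have "a\<^sup>2 * \<alpha>\<^sup>2 + b\<^sup>2 * \<beta>\<^sup>2 = \<rho>\<^sup>2 * (t1\<^sup>2 / a\<^sup>2 + t2\<^sup>2 / b\<^sup>2)"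
      unfolding \<alpha>_def \<beta>_def using ab by (simp add: power2_eq_square field_simps)
    then show ?thesis using el by simp
  qed
  (* p and q are the two points where the line meets the unit circle; Vieta's formulas for the
     quadratics of their coordinates give p1 * q1 and p2 * q2 in terms of the line. *)
  define D where "D = \<alpha>\<^sup>2 + \<beta>\<^sup>2"
  have D0: "D \<noteq> 0" using lp unfolding D_def by (auto simp: sum_power2_eq_zero_iff)
  have par: "\<beta> * (p1 + q1) = \<alpha> * (p2 + q2)"
  proof -
    have "(p1 - q1) * (\<beta> * (p1 + q1) - \<alpha> * (p2 + q2)) = 0"
      "(p2 - q2) * (\<beta> * (p1 + q1) - \<alpha> * (p2 + q2)) = 0"
      using p q lp lq by algebra+
    then show ?thesis using \<open>p \<noteq> q\<close> unfolding c by auto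
  qed
  have sum: "\<alpha> * (p1 + q1) + \<beta> * (p2 + q2) = 2" using lp lq by (simp add: algebra_simps)
  have s1: "D * (p1 + q1) = 2 * \<alpha>" and s2: "D * (p2 + q2) = 2 * \<beta>"
    using par sum unfolding D_def by algebra+
  have d1: "D * p1\<^sup>2 = 2 * \<alpha> * p1 - (1 - \<beta>\<^sup>2)" and d2: "D * p2\<^sup>2 = 2 * \<beta> * p2 - (1 - \<alpha>\<^sup>2)"
    using p lp unfolding D_def by algebra+
  have x: "D * (p1 * q1) = 1 - \<beta>\<^sup>2" and y: "D * (p2 * q2) = 1 - \<alpha>\<^sup>2"
    using s1 s2 d1 d2 by algebra+
  have "D * (\<rho> * (b * (p1 * q1) + a * (p2 * q2)) + a * b) = \<rho> * b * (D * (p1 * q1)) + \<rho> * a * (D * (p2 * q2)) + a * b * D"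
    by (simp add: algebra_simps)
  also have "\<dots> = \<rho>\<^sup>2 - (a\<^sup>2 * \<alpha>\<^sup>2 + b\<^sup>2 * \<beta>\<^sup>2)"
    unfolding x y unfolding D_def \<rho>_def by (simp add: algebra_simps power2_eq_square)
  finally have "\<rho> * (b * (p1 * q1) + a * (p2 * q2)) + a * b = 0"
    using D0 nf by simp
  then have "b * (p1 * q1) + a * (p2 * q2) = - (a * b) / \<rho>"
    using \<rho> by (simp add: field_simps)
  then have "(b * (p1 * q1) + a * (p2 * q2)) / (a * b) = - 1 / \<rho>"
    using ab by simp
  moreover have "p1 * q1 / a + p2 * q2 / b = (b * (p1 * q1) + a * (p2 * q2)) / (a * b)"
    using ab by (simp add: field_simps)
  ultimately show ?thesis unfolding conjugate_points_def c \<rho>_def by simp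
qed

text \<open>Conjugacy to \<open>r\<close> puts the two other vertices on one line, which is the tangent of the caustic at the
  point \<open>(- a * fst r, - b * snd r)\<close>. So the third vertex provides the point of contact.\<close>

lemma self_polar_side_tangent:
  assumes ab: "a > 0" "b > 0" and sp: "self_polar a b p q r"
  shows "side_tangent_to_ellipse a b ((a + b) *\<^sub>R p) ((a + b) *\<^sub>R q)"
proof -
  define \<rho> where "\<rho> = a + b"
  have \<rho>: "\<rho> > 0" using ab unfolding \<rho>_def by simp
  (* T is the pole, for the caustic, of the line of all points conjugate to r *)
  define T where "T = (- a * fst r, - b * snd r)"
  define n where "n = (fst T / a\<^sup>2, snd T / b\<^sup>2)"
  have n: "n = (- fst r / a, - snd r / b)" unfolding n_def T_def using ab by (simp add: power2_eq_square)
  have r: "(fst r)\<^sup>2 + (snd r)\<^sup>2 = 1" using sp unfolding self_polar_def insert_subset unit_point by blast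
  have n0: "n \<noteq> 0" using r ab unfolding n by (auto simp: prod_eq_iff)
  have T: "T \<in> ellipse a b" using r ab unfolding ellipse_def T_def by (simp add: power_mult_distrib)
  have nT: "n \<bullet> T = 1" using r ab unfolding n T_def by (simp add: power2_eq_square)
  have line: "ellipse_tangent_line a b T = {X. n \<bullet> X = 1}"
    unfolding ellipse_tangent_line_def n_def[symmetric] using nT
    by (auto simp: inner_diff_left inner_diff_right inner_commute)
  have vertex: "n \<bullet> (\<rho> *\<^sub>R x) = 1" if "conjugate_points a b r x" for x
  proof -
    have "n \<bullet> (\<rho> *\<^sub>R x) = - \<rho> * (fst r * fst x / a + snd r * snd x / b)"
      unfolding n inner_point by (simp add: algebra_simps)
    also have "\<dots> = - \<rho> * (- 1 / \<rho>)" using that unfolding conjugate_points_def \<rho>_def by simp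
    also have "\<dots> = 1" using \<rho> by simp
    finally show ?thesis .
  qed
  have np: "n \<bullet> (\<rho> *\<^sub>R p) = 1" and nq: "n \<bullet> (\<rho> *\<^sub>R q) = 1"
    using sp unfolding self_polar_def
    by (intro vertex; simp add: conjugate_points_def mult.commute)+
  have pq: "\<rho> *\<^sub>R p \<noteq> \<rho> *\<^sub>R q" using self_polar_distinct[OF assms] \<rho> by simp
  have on_line: "\<exists>t. X = \<rho> *\<^sub>R p + t *\<^sub>R (\<rho> *\<^sub>R q - \<rho> *\<^sub>R p)" if "n \<bullet> X = 1" for X
    by (rule line_through_two_points[of n "\<rho> *\<^sub>R q" "\<rho> *\<^sub>R p" X])
      (use that np nq n0 pq in \<open>auto simp: inner_diff_right\<close>)
  have hull: "affine hull {\<rho> *\<^sub>R p, \<rho> *\<^sub>R q} = ellipse_tangent_line a b T"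
  proof
    show "affine hull {\<rho> *\<^sub>R p, \<rho> *\<^sub>R q} \<subseteq> ellipse_tangent_line a b T"
      unfolding line using np nq by (intro hull_minimal affine_hyperplane) simp
    show "ellipse_tangent_line a b T \<subseteq> affine hull {\<rho> *\<^sub>R p, \<rho> *\<^sub>R q}"
    proof
      fix X assume "X \<in> ellipse_tangent_line a b T"
      then obtain t where "X = \<rho> *\<^sub>R p + t *\<^sub>R (\<rho> *\<^sub>R q - \<rho> *\<^sub>R p)"
        using on_line unfolding line by blast
      then have "X = (1 - t) *\<^sub>R (\<rho> *\<^sub>R p) + t *\<^sub>R (\<rho> *\<^sub>R q)" by (simp add: algebra_simps)
      then show "X \<in> affine hull {\<rho> *\<^sub>R p, \<rho> *\<^sub>R q}"
        unfolding affine_hull_2 mem_Collect_eq by (intro exI[of _ "1 - t"] exI[of _ t]) simp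
    qed
  qed
  (* the caustic lies inside the circle, and a line meets the disc exactly in the chord *)
  have "T \<in> closed_segment (\<rho> *\<^sub>R p) (\<rho> *\<^sub>R q)"
  proof -
    obtain t where t: "T = \<rho> *\<^sub>R p + t *\<^sub>R (\<rho> *\<^sub>R q - \<rho> *\<^sub>R p)" using on_line nT by blast
    have u: "p \<bullet> p = 1" "q \<bullet> q = 1" using sp unfolding self_polar_def by (auto simp: norm_eq_1)
    have "T \<bullet> T = \<rho>\<^sup>2 * (1 - t * (1 - t) * ((q - p) \<bullet> (q - p)))"
      unfolding t using u
      by (simp add: inner_diff_left inner_diff_right inner_add_left inner_add_right
          inner_commute[of q p] power2_eq_square algebra_simps)
    moreover have "T \<bullet> T < \<rho>\<^sup>2"
    proof -
      have "T \<bullet> T = a\<^sup>2 * (fst r)\<^sup>2 + b\<^sup>2 * (snd r)\<^sup>2"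
        unfolding T_def inner_point by (simp add: power2_eq_square algebra_simps)
      also have "\<dots> \<le> a\<^sup>2 * 1 + b\<^sup>2 * 1"
        using r zero_le_power2[of "fst r"] zero_le_power2[of "snd r"]
        by (intro add_mono mult_left_mono zero_le_power2) linarith+
      also have "\<dots> < \<rho>\<^sup>2" unfolding \<rho>_def power2_sum using ab by simp
      finally show ?thesis .
    qed
    ultimately have "0 < \<rho>\<^sup>2 * (t * (1 - t) * ((q - p) \<bullet> (q - p)))" by (simp add: algebra_simps)
    then have "0 < t * (1 - t) * ((q - p) \<bullet> (q - p))" using \<rho> by (simp add: zero_less_mult_iff)
    then have "0 < t * (1 - t)" by (metis inner_ge_zero mult_nonpos_nonneg not_less)
    then have "0 \<le> t" "t \<le> 1" by (auto simp: zero_less_mult_iff)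
    moreover have "T = (1 - t) *\<^sub>R (\<rho> *\<^sub>R p) + t *\<^sub>R (\<rho> *\<^sub>R q)" unfolding t by (simp add: algebra_simps)
    ultimately show ?thesis unfolding closed_segment_def by blast
  qed
  then show ?thesis unfolding side_tangent_to_ellipse_def \<rho>_def[symmetric] using T hull by blast
qed

text \<open>This replaces tangency, with its existentially quantified points of contact, by three
  bilinear equations.\<close>

lemma circumcircle_family_self_polar:
  assumes ab: "a > 0" "b > 0"
  shows "circumcircle_family a b
    = (\<lambda>(p, q, r). ((a + b) *\<^sub>R p, (a + b) *\<^sub>R q, (a + b) *\<^sub>R r)) ` {(p, q, r). self_polar a b p q r}"
    (is "_ = ?S ` _")
proof -
  have \<rho>: "a + b > 0" using ab by simp
  have unit: "\<exists>p. P = (a + b) *\<^sub>R p \<and> p \<in> sphere 0 1" if "P \<in> sphere 0 (a + b)" for P :: point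
    using that \<rho> by (intro exI[of _ "(1 / (a + b)) *\<^sub>R P"]) (simp add: divide_self)
  have conj: "conjugate_points a b p q"
    if "p \<in> sphere 0 1" "q \<in> sphere 0 1" "p \<noteq> q" "side_tangent_to_ellipse a b ((a + b) *\<^sub>R p) ((a + b) *\<^sub>R q)" for p q
    using that unfolding side_tangent_to_ellipse_def
    by (metis ab tangent_chord_imp_conjugate hull_inc insertCI)
  show ?thesis
  proof (intro equalityI subsetI)
    fix t assume "t \<in> circumcircle_family a b"
    then obtain P Q R where t: "t = (P, Q, R)" "\<not> collinear {P, Q, R}" "{P, Q, R} \<subseteq> sphere 0 (a + b)"
      "side_tangent_to_ellipse a b P Q" "side_tangent_to_ellipse a b Q R" "side_tangent_to_ellipse a b R P"
      unfolding circumcircle_family_def by blast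
    obtain p q r where e: "P = (a + b) *\<^sub>R p" "Q = (a + b) *\<^sub>R q" "R = (a + b) *\<^sub>R r"
      and u: "p \<in> sphere 0 1" "q \<in> sphere 0 1" "r \<in> sphere 0 1"
      using unit t(3) by (metis insert_subset)
    have "P \<noteq> Q" "Q \<noteq> R" "R \<noteq> P" using t(2) by (auto simp: insert_commute)
    then have "p \<noteq> q" "q \<noteq> r" "r \<noteq> p" unfolding e by auto
    then have "self_polar a b p q r" unfolding self_polar_def using u t(4-6) conj unfolding e by blast
    then show "t \<in> ?S ` {(p, q, r). self_polar a b p q r}" unfolding t(1) e by force
  next
    fix t assume "t \<in> ?S ` {(p, q, r). self_polar a b p q r}"
    then obtain p q r where sp: "self_polar a b p q r"
      and t: "t = ((a + b) *\<^sub>R p, (a + b) *\<^sub>R q, (a + b) *\<^sub>R r)" by auto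
    have "signed_area2 ((a + b) *\<^sub>R p) ((a + b) *\<^sub>R q) ((a + b) *\<^sub>R r) = (a + b)\<^sup>2 * signed_area2 p q r"
      unfolding signed_area2_def by (simp add: algebra_simps power2_eq_square)
    then have "\<not> collinear {(a + b) *\<^sub>R p, (a + b) *\<^sub>R q, (a + b) *\<^sub>R r}"
      using collinear_imp_signed_area2_0 self_polar_area_nonzero[OF ab sp] \<rho> by fastforce
    moreover have "{(a + b) *\<^sub>R p, (a + b) *\<^sub>R q, (a + b) *\<^sub>R r} \<subseteq> sphere 0 (a + b)"
      using sp \<rho> unfolding self_polar_def by auto
    ultimately show "t \<in> circumcircle_family a b"
      unfolding circumcircle_family_def t
      using self_polar_side_tangent[OF ab sp]
        self_polar_side_tangent[OF ab self_polar_rotate[OF sp]]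
        self_polar_side_tangent[OF ab self_polar_rotate[OF self_polar_rotate[OF sp]]]
      by simp
  qed
qed

section \<open>The product of the cosines in the circumcircle family\<close>

definition point_of :: "complex \<Rightarrow> point" where "point_of z = (Re z, Im z)"

lemma norm_point_of: "norm (point_of z) = cmod z"
  unfolding point_of_def by (simp add: norm_Pair cmod_def)

lemma unit_cnj: "cmod z = 1 \<Longrightarrow> z * cnj z = 1"
  by (simp add: complex_norm_square[symmetric])

text \<open>For points of the unit circle the real parts are the cosines of the sum and the difference of
  the two arguments.\<close>

lemma conjugate_point_of:
  assumes ab: "a > 0" "b > 0" and f: "f = (a - b) / (a + b)"
  shows "conjugate_points a b (point_of u) (point_of v)
    \<longleftrightarrow> 2 * f * Re (u * v) - (1 - f\<^sup>2) = 2 * Re (u * cnj v)"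
proof -
  define X Y where "X = Re u * Re v" and "Y = Im u * Im v"
  define \<rho> where "\<rho> = a + b"
  have \<rho>: "\<rho> > 0" using ab unfolding \<rho>_def by simp
  have f': "\<rho> * f = a - b" unfolding f \<rho>_def using ab by simp
  have "\<rho>\<^sup>2 * (2 * f * Re (u * v) - (1 - f\<^sup>2) - 2 * Re (u * cnj v))
     = 2 * \<rho> * (\<rho> * f) * (X - Y) - \<rho>\<^sup>2 + (\<rho> * f)\<^sup>2 - 2 * \<rho>\<^sup>2 * (X + Y)"
    unfolding X_def Y_def by (simp add: power2_eq_square algebra_simps)
  also have "\<dots> = - 4 * (\<rho> * (b * X + a * Y) + a * b)"
    unfolding f' unfolding \<rho>_def by (simp add: power2_eq_square algebra_simps)
  finally have "2 * f * Re (u * v) - (1 - f\<^sup>2) = 2 * Re (u * cnj v) \<longleftrightarrow> \<rho> * (b * X + a * Y) + a * b = 0"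
    using \<rho> by (smt (verit) mult_eq_0_iff zero_eq_power2)
  also have "\<dots> \<longleftrightarrow> a * b * \<rho> * (X / a + Y / b + 1 / \<rho>) = 0"
    using ab \<rho> by (simp add: algebra_simps)
  also have "\<dots> \<longleftrightarrow> conjugate_points a b (point_of u) (point_of v)"
    using ab \<rho> unfolding conjugate_points_def point_of_def X_def Y_def \<rho>_def[symmetric]
    by (auto simp: add_eq_0_iff2)
  finally show ?thesis ..
qed

text \<open>Poncelet's porism for this family in one equation: the second elementary symmetric function of
  the vertices is the same for all triangles.\<close>

lemma self_polar_complex_sum:
  assumes ab: "a > 0" "b > 0" and f: "f = (a - b) / (a + b)"
    and sp: "self_polar a b (point_of u) (point_of v) (point_of w)"
  shows "u * v + v * w + w * u = - of_real f"
proof -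
  have n: "cmod u = 1" "cmod v = 1" "cmod w = 1"
    using sp unfolding self_polar_def by (auto simp: norm_point_of)
  (* for fixed s this is a quadratic equation in t, so v and w are its two roots for s = u *)
  have quad: "of_real f * (s\<^sup>2 * t\<^sup>2 + 1) - (1 - of_real f ^ 2) * s * t = s\<^sup>2 + t\<^sup>2"
    if "conjugate_points a b (point_of s) (point_of t)" "cmod s = 1" "cmod t = 1" for s t
  proof -
    have "complex_of_real (2 * f * Re (s * t) - (1 - f\<^sup>2)) = of_real (2 * Re (s * cnj t))"
      using that conjugate_point_of[OF ab f] by simp
    then have "of_real f * (s * t + cnj (s * t)) - (1 - of_real f ^ 2) = s * cnj t + cnj (s * cnj t)"
      unfolding complex_add_cnj by (simp add: mult_ac)
    then have "(of_real f * (s * t + cnj s * cnj t) - (1 - of_real f ^ 2)) * (s * t)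
        = (s * cnj t + cnj s * t) * (s * t)"
      by simp
    moreover have "s * cnj s = 1" "t * cnj t = 1" using that unit_cnj by auto
    ultimately show ?thesis by algebra
  qed
  define F where "F = complex_of_real f"
  have E1: "F * (u\<^sup>2 * v\<^sup>2 + 1) - (1 - F ^ 2) * u * v = u\<^sup>2 + v\<^sup>2"
    using sp n unfolding self_polar_def F_def by (intro quad) auto
  have E2: "F * (u\<^sup>2 * w\<^sup>2 + 1) - (1 - F ^ 2) * u * w = u\<^sup>2 + w\<^sup>2"
  proof -
    have "F * (w\<^sup>2 * u\<^sup>2 + 1) - (1 - F ^ 2) * w * u = w\<^sup>2 + u\<^sup>2"
      using sp n unfolding self_polar_def F_def by (intro quad) auto
    then show ?thesis by (simp only: mult_ac add_ac)
  qed
  have vw: "v - w \<noteq> 0" using self_polar_distinct[OF ab sp] by auto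
  have "(v - w) * ((F * u\<^sup>2 - 1) * (v + w) - (1 - F\<^sup>2) * u) = 0" using E1 E2 by algebra
  then have s: "(F * u\<^sup>2 - 1) * (v + w) = (1 - F\<^sup>2) * u" using vw by simp
  have "(v - w) * ((F * u\<^sup>2 - 1) * (v * w) - (F - u\<^sup>2)) = 0" using E1 E2 by algebra
  then have p: "(F * u\<^sup>2 - 1) * (v * w) = F - u\<^sup>2" using vw by simp
  have "cmod (F * u\<^sup>2) < 1"
    unfolding norm_mult norm_power n F_def norm_of_real f using ab by (simp add: abs_less_iff)
  then have nz: "F * u\<^sup>2 - 1 \<noteq> 0" by auto
  have "(F * u\<^sup>2 - 1) * (u * v + v * w + w * u + F) = 0" using s p by algebra
  then show ?thesis using nz unfolding F_def by (simp add: add_eq_0_iff2)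
qed

text \<open>On the unit circle conjugation is inversion, so the sum is the conjugate of the pair sum multiplied by
  the product of the three points, which has modulus one.\<close>

lemma unit_sum_norm:
  assumes "cmod u = 1" "cmod v = 1" "cmod w = 1"
  shows "cmod (u + v + w) = cmod (u * v + v * w + w * u)"
proof -
  have "u + v + w = (u * v * w) * cnj (u * v + v * w + w * u)"
    using assms[THEN unit_cnj] by simp algebra
  then show ?thesis using assms by (simp add: norm_mult del: complex_cnj_add)
qed

text \<open>Solving the equation for \<open>w\<close> and taking absolute values eliminates \<open>w\<close>.\<close>

lemma conjugate_if_pair_sum:
  assumes ab: "a > 0" "b > 0" and f: "f = (a - b) / (a + b)"
    and n: "cmod u = 1" "cmod v = 1" "cmod w = 1"
    and e: "u * v + v * w + w * u = - of_real f"
  shows "conjugate_points a b (point_of u) (point_of v)"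
proof -
  have "(u + v) * w = - (of_real f + u * v)" using e by (simp add: algebra_simps eq_neg_iff_add_eq_0)
  then have "(cmod (u + v))\<^sup>2 = (cmod (of_real f + u * v))\<^sup>2" using n by (metis norm_minus_cancel norm_mult mult.right_neutral)
  moreover have "(cmod (u + v))\<^sup>2 = (cmod u)\<^sup>2 + (cmod v)\<^sup>2 + 2 * Re (u * cnj v)"
    unfolding cmod_power2 by (simp add: power2_eq_square algebra_simps)
  moreover have "(cmod (of_real f + u * v))\<^sup>2 = f\<^sup>2 + (cmod (u * v))\<^sup>2 + 2 * f * Re (u * v)"
    unfolding cmod_power2 by (simp add: power2_eq_square algebra_simps)
  ultimately show ?thesis unfolding conjugate_point_of[OF ab f] using n by (simp add: norm_mult)
qed

lemma self_polar_if_pair_sum: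
  assumes ab: "a > 0" "b > 0" and f: "f = (a - b) / (a + b)"
    and n: "cmod u = 1" "cmod v = 1" "cmod w = 1"
    and e: "u * v + v * w + w * u = - of_real f"
  shows "self_polar a b (point_of u) (point_of v) (point_of w)"
  unfolding self_polar_def
  using n conjugate_if_pair_sum[OF ab f n e]
    conjugate_if_pair_sum[OF ab f n(2,3,1)] conjugate_if_pair_sum[OF ab f n(3,1,2)] e
  by (simp add: norm_point_of add_ac)

text \<open>The squared distance of the orthocentre from the centre, in units of the circumradius, as it
  enters the formula for the product of the cosines.\<close>

lemma ratio_square:
  assumes "(a::real) + b \<noteq> 0"
  shows "((a - b) / (a + b))\<^sup>2 = 1 - 8 * (a * b / (2 * (a + b)\<^sup>2))"
proof -
  have "1 - 8 * (a * b / (2 * (a + b)\<^sup>2)) = ((a + b)\<^sup>2 - 4 * (a * b)) / (a + b)\<^sup>2"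
    using assms by (simp add: diff_divide_distrib)
  also have "(a + b)\<^sup>2 - 4 * (a * b) = (a - b)\<^sup>2" by (simp add: power2_eq_square algebra_simps)
  finally show ?thesis by (simp only: power_divide)
qed

text \<open>By the constant pair sum, all triangles of the family have their orthocentre at the same distance
  from the centre.\<close>

lemma self_polar_cosine_product:
  assumes ab: "a > 0" "b > 0" and sp: "self_polar a b p q r"
    and c: "cosine_triple (p, q, r) = (x, y, z)"
  shows "x * y * z = a * b / (2 * (a + b)\<^sup>2)"
proof -
  define f where f: "f = (a - b) / (a + b)"
  define u v w where "u = Complex (fst p) (snd p)" and "v = Complex (fst q) (snd q)"
    and "w = Complex (fst r) (snd r)"
  have pt: "point_of u = p" "point_of v = q" "point_of w = r"
    unfolding u_def v_def w_def point_of_def by simp_all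
  have n: "cmod u = 1" "cmod v = 1" "cmod w = 1"
    using sp unfolding self_polar_def pt[symmetric] by (auto simp: norm_point_of)
  have "norm (p + q + r) = cmod (u + v + w)"
    unfolding pt[symmetric] point_of_def by (simp add: norm_Pair cmod_def)
  also have "\<dots> = \<bar>f\<bar>"
    unfolding unit_sum_norm[OF n] using self_polar_complex_sum[OF ab f] sp unfolding pt[symmetric] by simp
  finally have "8 * (x * y * z) = 1 - f\<^sup>2"
    using unit_triangle_cosine_product[OF self_polar_distinct[OF ab sp] c] sp
    unfolding self_polar_def by simp
  also have "\<dots> = 8 * (a * b / (2 * (a + b)\<^sup>2))"
    unfolding f using ratio_square[of a b] ab by simp
  finally show ?thesis by simp
qed

section \<open>The product of the cosines in the excentral family\<close>

text \<open>For a vertex \<open>p\<close> of a self-polar triangle this is an inward normal of the side of the stretched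
  triangle opposite to the image of \<open>p\<close>. The scaling by a common factor is chosen so that the inner product of two such normals
  becomes \<open>p \<bullet> q - 1\<close> for conjugate \<open>p\<close> and \<open>q\<close>.\<close>

definition side_normal :: "real \<Rightarrow> real \<Rightarrow> point \<Rightarrow> point" where
  "side_normal a b p = (sqrt ((2 * a + b) / a) * fst p, sqrt ((2 * b + a) / b) * snd p)"

definition stretch :: "real \<Rightarrow> real \<Rightarrow> point \<Rightarrow> point" where
  "stretch a b = (\<lambda>(x, y). (sqrt ((2 * b\<^sup>2 + a * b) / (2 * a\<^sup>2 + a * b)) * x, y))"

text \<open>The stretching factor is exactly the one for which the inner product is a multiple of the
  conjugacy form.\<close>

lemma side_normal_stretch:
  assumes ab: "a > 0" "b > 0"
  shows "side_normal a b p \<bullet> stretch a b x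
    = sqrt (b * (2 * b + a)) * (fst p * fst x / a + snd p * snd x / b)"
proof -
  define c where "c = sqrt (b * (2 * b + a))"
  have 1: "sqrt ((2 * a + b) / a) * sqrt ((2 * b\<^sup>2 + a * b) / (2 * a\<^sup>2 + a * b)) = c / a"
  proof -
    have "(2 * a + b) / a * ((2 * b\<^sup>2 + a * b) / (2 * a\<^sup>2 + a * b)) = b * (2 * b + a) / a\<^sup>2"
    proof -
      have "2 * b\<^sup>2 + a * b = b * (2 * b + a)" "2 * a\<^sup>2 + a * b = a * (2 * a + b)"
        by (simp_all add: power2_eq_square algebra_simps)
      moreover have "2 * a + b \<noteq> 0" using ab by simp
      ultimately show ?thesis using ab by (simp add: power2_eq_square)
    qed
    then show ?thesis unfolding c_def real_sqrt_mult[symmetric]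
      using ab by (simp add: real_sqrt_divide)
  qed
  have 2: "sqrt ((2 * b + a) / b) = c / b"
  proof -
    have "(2 * b + a) / b = b * (2 * b + a) / b\<^sup>2" using ab by (simp add: power2_eq_square)
    then show ?thesis unfolding c_def using ab by (simp add: real_sqrt_divide)
  qed
  have "side_normal a b p \<bullet> stretch a b x
    = (sqrt ((2 * a + b) / a) * sqrt ((2 * b\<^sup>2 + a * b) / (2 * a\<^sup>2 + a * b))) * (fst p * fst x)
      + sqrt ((2 * b + a) / b) * (snd p * snd x)"
    unfolding side_normal_def stretch_def by (simp add: inner_point case_prod_beta)
  then show ?thesis unfolding 1 2 c_def[symmetric] by (simp add: algebra_simps)
qed

lemma linear_stretch: "stretch a b (x - y) = stretch a b x - stretch a b y"
  "stretch a b (c *\<^sub>R x) = c *\<^sub>R stretch a b x"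
  unfolding stretch_def by (simp_all add: case_prod_beta prod_eq_iff algebra_simps)

lemma stretch_injective:
  assumes "a > 0" "b > 0" "stretch a b p = stretch a b q"
  shows "p = q"
proof -
  have "sqrt ((2 * b\<^sup>2 + a * b) / (2 * a\<^sup>2 + a * b)) > 0"
    using assms(1,2) by (intro real_sqrt_gt_zero divide_pos_pos add_pos_pos) auto
  then show ?thesis using assms(3) unfolding stretch_def by (auto simp: prod_eq_iff case_prod_beta)
qed

text \<open>The sides through the image of \<open>r\<close> are opposite to those of \<open>q\<close> and \<open>p\<close>. Their normals are inward because the
  conjugacy form is positive definite, whereas its value at conjugate points is negative.\<close>

lemma cos_stretched_angle:
  assumes ab: "a > 0" "b > 0" and c: "conjugate_points a b p r" "conjugate_points a b q r" "conjugate_points a b p q"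
  shows "cos (internal_angle (stretch a b p) (stretch a b r) (stretch a b q))
    = - (side_normal a b q \<bullet> side_normal a b p) / (norm (side_normal a b q) * norm (side_normal a b p))"
proof (rule cos_internal_angle_normals)
  define k where "k = sqrt (b * (2 * b + a))"
  have k: "k > 0" using ab unfolding k_def by simp
  have sn: "side_normal a b s \<bullet> (stretch a b x - stretch a b y)
    = k * ((fst s * fst x / a + snd s * snd x / b) - (fst s * fst y / a + snd s * snd y / b))" for s x y
    unfolding inner_diff_right side_normal_stretch[OF ab] k_def by (simp only: right_diff_distrib)
  have c': "conjugate_points a b q p" "conjugate_points a b r p"  "conjugate_points a b r q"
    using c unfolding conjugate_points_def by (simp_all add: mult.commute)
  show "side_normal a b q \<bullet> (stretch a b p - stretch a b r) = 0"
    "side_normal a b p \<bullet> (stretch a b q - stretch a b r) = 0"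
    unfolding sn using c c' unfolding conjugate_points_def by simp_all
  have "0 < side_normal a b s \<bullet> (stretch a b s - stretch a b r)" if "conjugate_points a b s r" for s
  proof -
    have "0 < (fst s * fst s / a + snd s * snd s / b) + 1 / (a + b)"
      using ab by (intro add_nonneg_pos add_nonneg_nonneg) auto
    then show ?thesis unfolding sn using that k unfolding conjugate_points_def by simp
  qed
  from this[OF c(2)] this[OF c(1)]
  show "0 < side_normal a b q \<bullet> (stretch a b q - stretch a b r)
      * (side_normal a b p \<bullet> (stretch a b p - stretch a b r))"
    by (rule mult_pos_pos)
qed

lemma side_normal_inner:
  assumes ab: "a > 0" "b > 0"
  shows "side_normal a b p \<bullet> side_normal a b q
    = p \<bullet> q + (a + b) * (fst p * fst q / a + snd p * snd q / b)"
proof -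
  have "side_normal a b p \<bullet> side_normal a b q
    = (sqrt ((2 * a + b) / a))\<^sup>2 * (fst p * fst q) + (sqrt ((2 * b + a) / b))\<^sup>2 * (snd p * snd q)"
    unfolding side_normal_def inner_point by (simp only: fst_conv snd_conv power2_eq_square mult_ac)
  also have "(sqrt ((2 * a + b) / a))\<^sup>2 = 1 + (a + b) / a" using ab by (simp add: field_simps)
  also have "(sqrt ((2 * b + a) / b))\<^sup>2 = 1 + (a + b) / b" using ab by (simp add: field_simps)
  finally show ?thesis unfolding inner_point by (simp add: algebra_simps)
qed

text \<open>The cosine of the angle between the normals belonging to \<open>p\<close> and \<open>q\<close> is \<open>1 - p \<bullet> q\<close> divided by two
  weighted lengths, up to sign. So the product of the cosines is a quotient of the two Gram determinants,
  which does not depend on the triangle.\<close>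

lemma stretched_self_polar_cosine_product:
  assumes ab: "a > 0" "b > 0" and sp: "self_polar a b p q r"
    and c: "cosine_triple (stretch a b p, stretch a b q, stretch a b r) = (x, y, z)"
  shows "x * y * z = a * b / (2 * (a + b)\<^sup>2)"
proof -
  define N where "N = side_normal a b"
  define w where "w = (\<lambda>p :: point. (a + b) / a * (fst p)\<^sup>2 + (a + b) / b * (snd p)\<^sup>2 + 1)"
  have cj: "conjugate_points a b p q" "conjugate_points a b q r" "conjugate_points a b r p"
    using sp unfolding self_polar_def by auto
  have cj': "conjugate_points a b q p" "conjugate_points a b r q" "conjugate_points a b p r"
    using cj unfolding conjugate_points_def by (simp_all add: mult.commute)
  have u: "p \<bullet> p = 1" "q \<bullet> q = 1" "r \<bullet> r = 1"
    using sp unfolding self_polar_def by (auto simp: norm_eq_1)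
  have NN: "(norm (N s))\<^sup>2 = w s" if "s \<bullet> s = 1" for s
    unfolding power2_norm_eq_inner N_def side_normal_inner[OF ab] that w_def
    by (simp add: power2_eq_square algebra_simps)
  have off: "- (N s \<bullet> N t) = 1 - t \<bullet> s" if "conjugate_points a b t s" for s t
    using that ab unfolding N_def side_normal_inner[OF ab] conjugate_points_def
    by (simp add: mult.commute[of "fst s"] mult.commute[of "snd s"] inner_commute)
  have cs: "cos (internal_angle (stretch a b s) (stretch a b u) (stretch a b t))
      = (1 - s \<bullet> t) / (norm (N s) * norm (N t))"
    if "conjugate_points a b s u" "conjugate_points a b t u" "conjugate_points a b s t" for s t u
    unfolding cos_stretched_angle[OF ab that] off[OF that(3), unfolded N_def]
    unfolding N_def by (simp only: mult.commute)
  have "x = (1 - q \<bullet> r) / (norm (N q) * norm (N r))"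
    "y = (1 - r \<bullet> p) / (norm (N r) * norm (N p))"
    "z = (1 - p \<bullet> q) / (norm (N p) * norm (N q))"
    using c unfolding cosine_triple_def
    by (simp_all add: cs[OF cj(3) cj'(1) cj'(2)] cs[OF cj(1) cj'(2) cj'(3)] cs[OF cj(2) cj'(3) cj'(1)]
        inner_commute mult.commute)
  then have "x * y * z = (1 - p \<bullet> q) * (1 - q \<bullet> r) * (1 - r \<bullet> p)
      / ((norm (N p))\<^sup>2 * (norm (N q))\<^sup>2 * (norm (N r))\<^sup>2)"
    by (simp only: times_divide_times_eq power2_eq_square mult_ac)
  also have "\<dots> = (2 * (1 - p \<bullet> q) * (1 - q \<bullet> r) * (1 - r \<bullet> p)) / 2 / ((a + b)\<^sup>2 / (a * b) * (signed_area2 p q r)\<^sup>2)"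
    unfolding NN[OF u(1)] NN[OF u(2)] NN[OF u(3)] w_def self_polar_gram(1)[OF ab sp]
    by (simp only: mult.assoc)
  also have "\<dots> = a * b / (2 * (a + b)\<^sup>2)"
    unfolding self_polar_gram(2)[OF ab sp]
    using self_polar_area_nonzero[OF ab sp] ab by simp
  finally show ?thesis .
qed

section \<open>Triangles with prescribed cosines\<close>

text \<open>The cosines of a triangle prescribe the mutual angles of its unit outward normals; by the identity
  of the three cosines these angles are consistent. The remaining freedom is a rotation. The sum
  of the squares of the normals, as complex numbers, has absolute value \<open>\<bar>f\<bar>\<close>, and the rotation makes it equal
  to \<open>f\<close>. This normalisation selects the triangles of both families.\<close>

lemma exists_side_normals:
  fixes x y z f :: real
  assumes pos: "x > 0" "y > 0" "z > 0" and id: "x\<^sup>2 + y\<^sup>2 + z\<^sup>2 + 2 * (x * y * z) = 1"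
    and f: "f\<^sup>2 = 1 - 8 * (x * y * z)"
  obtains n1 n2 n3 :: complex where "cmod n1 = 1" "cmod n2 = 1" "cmod n3 = 1"
    "Re (n2 * cnj n3) = - x" "Re (n3 * cnj n1) = - y" "Re (n1 * cnj n2) = - z"
    "0 < Im (cnj n2 * n3)" "0 < Im (cnj n3 * n1)" "0 < Im (cnj n1 * n2)"
    "n1\<^sup>2 + n2\<^sup>2 + n3\<^sup>2 = of_real f"
proof -
  have xyz: "0 < x * y * z" using pos by simp
  have y1: "y\<^sup>2 < 1" using id xyz pos by (smt (verit) zero_le_power2 zero_less_power)
  have z1: "z\<^sup>2 < 1" using id xyz pos by (smt (verit) zero_le_power2 zero_less_power)
  define s t where "s = sqrt (1 - z\<^sup>2)" and "t = sqrt (1 - y\<^sup>2)"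
  have s: "s > 0" "s\<^sup>2 = 1 - z\<^sup>2" and t: "t > 0" "t\<^sup>2 = 1 - y\<^sup>2"
    using y1 z1 unfolding s_def t_def by simp_all
  have st: "s * t = x + y * z"
  proof (rule power2_eq_imp_eq)
    show "(s * t)\<^sup>2 = (x + y * z)\<^sup>2"
      unfolding power_mult_distrib s t using id by (simp add: power2_eq_square algebra_simps)
  qed (use s t pos in auto)
  (* one normal is put in direction 1; the angle between two normals is supplementary
     to the angle of the triangle between the two sides *)
  define m1 m2 m3 where "m1 = (1 :: complex)" and "m2 = Complex (- z) s" and "m3 = Complex (- y) (- t)"
  have m: "cmod m1 = 1" "cmod m2 = 1" "cmod m3 = 1"
    unfolding m1_def m2_def m3_def cmod_def using s t by simp_all
  have dots: "Re (m2 * cnj m3) = - x" "Re (m3 * cnj m1) = - y" "Re (m1 * cnj m2) = - z"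
    unfolding m1_def m2_def m3_def using st by simp_all
  have crosses: "0 < Im (cnj m2 * m3)" "0 < Im (cnj m3 * m1)" "0 < Im (cnj m1 * m2)"
    unfolding m1_def m2_def m3_def using pos s t by (simp_all add: add_pos_pos mult.commute)
  define \<sigma> where "\<sigma> = m1\<^sup>2 + m2\<^sup>2 + m3\<^sup>2"
  have "(cmod \<sigma>)\<^sup>2 = f\<^sup>2"
  proof -
    have "Re \<sigma> = 2 * y\<^sup>2 + 2 * z\<^sup>2 - 1" "Im \<sigma> = 2 * (y * t - z * s)"
      unfolding \<sigma>_def m1_def m2_def m3_def using s t by (simp_all add: power2_eq_square algebra_simps)
    then have "(cmod \<sigma>)\<^sup>2 = (2 * y\<^sup>2 + 2 * z\<^sup>2 - 1)\<^sup>2 + 4 * (y * t - z * s)\<^sup>2"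
      unfolding cmod_power2 by (simp only: power_mult_distrib) simp
    also have "(y * t - z * s)\<^sup>2 = y\<^sup>2 * t\<^sup>2 + z\<^sup>2 * s\<^sup>2 - 2 * y * z * (s * t)"
      by (simp add: power2_eq_square algebra_simps)
    finally show ?thesis unfolding s t st f by (simp add: power2_eq_square algebra_simps)
  qed
  then have norm\<sigma>: "cmod \<sigma> = \<bar>f\<bar>" by (metis abs_norm_cancel power2_eq_iff abs_minus_cancel abs_eq_iff)
  (* a rotation by the angle of nu multiplies the sum of squares by nu squared *)
  obtain \<nu> where \<nu>: "cmod \<nu> = 1" "\<nu>\<^sup>2 * \<sigma> = of_real f"
  proof (cases "f = 0")
    case True
    then show ?thesis using norm\<sigma> by (intro that[of 1]) auto
  next
    case False
    then have "\<sigma> \<noteq> 0" using norm\<sigma> by auto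
    moreover have "cmod (csqrt (of_real f / \<sigma>)) = 1"
      using norm\<sigma> False by (simp add: norm_divide)
    ultimately show ?thesis by (intro that[of "csqrt (of_real f / \<sigma>)"]) simp_all
  qed
  have inv: "(\<nu> * s) * cnj (\<nu> * t) = s * cnj t" "cnj (\<nu> * s) * (\<nu> * t) = cnj s * t" for s t
    using unit_cnj[OF \<nu>(1)] by (simp_all add: mult.assoc) algebra+
  show thesis
    by (rule that[of "\<nu> * m1" "\<nu> * m2" "\<nu> * m3"])
      (use m \<nu> dots crosses in \<open>simp_all only: inv norm_mult mult_1 power_mult_distrib distrib_left[symmetric] \<sigma>_def\<close>)
qed

text \<open>The vertices of an inscribed triangle are, up to a common rotation, products of its side normals
  and their conjugates. The vertices can be chosen such that their pair sum is the negative conjugate of the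
  sum of the squares of the normals, which is the condition for self-polarity.\<close>

lemma self_polar_with_cosines:
  assumes ab: "a > 0" "b > 0" and pos: "x > 0" "y > 0" "z > 0"
    and id: "x\<^sup>2 + y\<^sup>2 + z\<^sup>2 + 2 * (x * y * z) = 1" and k: "x * y * z = a * b / (2 * (a + b)\<^sup>2)"
  obtains p q r where "self_polar a b p q r" "cosine_triple (p, q, r) = (x, y, z)"
proof -
  define f where f: "f = (a - b) / (a + b)"
  have "f\<^sup>2 = 1 - 8 * (x * y * z)"
    unfolding k f using ab by (intro ratio_square) simp
  from exists_side_normals[OF pos id this] obtain n1 n2 n3 where
    n: "cmod n1 = 1" "cmod n2 = 1" "cmod n3 = 1"
    and dots: "Re (n2 * cnj n3) = - x" "Re (n3 * cnj n1) = - y" "Re (n1 * cnj n2) = - z"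
    and crosses: "0 < Im (cnj n2 * n3)" "0 < Im (cnj n3 * n1)" "0 < Im (cnj n1 * n2)"
    and sum: "n1\<^sup>2 + n2\<^sup>2 + n3\<^sup>2 = of_real f" by blast
  note c = n[THEN unit_cnj]
  (* Each vertex is determined by the two sides through it; the factor of modulus one common to
     all three vertices rotates the triangle so that the pair sum becomes the required real number.
     Its side normals are the mirror images side n of the normals n. *)
  define vert where "vert = (\<lambda>l m n. \<i> * l * cnj m * cnj n)"
  define side where "side = (\<lambda>n. - (\<i> * cnj n))"
  define u v w where "u = vert n1 n2 n3" and "v = vert n2 n3 n1" and "w = vert n3 n1 n2"
  have un: "cmod u = 1" "cmod v = 1" "cmod w = 1"
    unfolding u_def v_def w_def vert_def by (simp_all add: norm_mult n)
  have "u * v + v * w + w * u = - cnj (n1\<^sup>2 + n2\<^sup>2 + n3\<^sup>2)"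
  proof -
    have "\<i> * \<i> = -1" by simp
    then show ?thesis unfolding u_def v_def w_def vert_def complex_cnj_add complex_cnj_power using c by algebra
  qed
  then have sp: "self_polar a b (point_of u) (point_of v) (point_of w)"
    using self_polar_if_pair_sum[OF ab f un] unfolding sum by simp
  have dot: "point_of s \<bullet> point_of t = Re (s * cnj t)" for s t
    unfolding point_of_def by simp
  have diff: "point_of s - point_of t = point_of (s - t)" for s t
    unfolding point_of_def by simp
  have ii: "\<i> * \<i> = -1" by simp
  have perp: "point_of (side l) \<bullet> (point_of (vert n l m) - point_of (vert m n l)) = 0"
    if "l * cnj l = 1" "m * cnj m = 1" "n * cnj n = 1" for l m n
  proof -
    have "side l * cnj (vert n l m - vert m n l) = - (m * cnj n - cnj m * n)"
      using that ii unfolding side_def vert_def complex_cnj_diff complex_cnj_mult complex_cnj_cnj complex_cnj_i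
      by algebra
    then show ?thesis unfolding diff dot by simp
  qed
  have out: "point_of (side l) \<bullet> (point_of (vert m n l) - point_of (vert l m n))
      = 2 * Im (cnj l * m) * Im (cnj n * l)"
    if "l * cnj l = 1" "m * cnj m = 1" "n * cnj n = 1" for l m n
  proof -
    have "side l * cnj (vert m n l - vert l m n) = - (cnj m * n - cnj l * cnj l * m * n)"
      using that ii unfolding side_def vert_def complex_cnj_diff complex_cnj_mult complex_cnj_cnj complex_cnj_i
      by algebra
    then have "point_of (side l) \<bullet> (point_of (vert m n l) - point_of (vert l m n))
      = Re (cnj l * cnj l * m * n - cnj m * n)"
      unfolding diff dot by (simp del: times_complex.sel complex_cnj_diff)
    also have "\<dots> = Re ((cnj l * m) * (cnj l * n) - cnj (cnj l * m) * (cnj l * n))"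
    proof (rule arg_cong[of _ _ Re])
      show "cnj l * cnj l * m * n - cnj m * n = (cnj l * m) * (cnj l * n) - cnj (cnj l * m) * (cnj l * n)"
        using that unfolding complex_cnj_mult complex_cnj_cnj by algebra
    qed
    also have "\<dots> = 2 * Im (cnj l * m) * Im (cnj n * l)"
      by (simp add: algebra_simps)
    finally show ?thesis .
  qed
  have cos: "cos (internal_angle (point_of (vert n l m)) (point_of (vert l m n)) (point_of (vert m n l)))
      = - Re (m * cnj n)"
    if "cmod l = 1" "cmod m = 1" "cmod n = 1"
      "0 < Im (cnj l * m)" "0 < Im (cnj m * n)" "0 < Im (cnj n * l)" for l m n
  proof -
    note cc = that(1-3)[THEN unit_cnj]
    have "cos (internal_angle (point_of (vert n l m)) (point_of (vert l m n)) (point_of (vert m n l)))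
      = - (point_of (side m) \<bullet> point_of (side n)) / (norm (point_of (side m)) * norm (point_of (side n)))"
    proof (rule cos_internal_angle_normals)
      show "point_of (side m) \<bullet> (point_of (vert n l m) - point_of (vert l m n)) = 0"
        using perp[of m n l] cc by (simp add: inner_diff_right)
      show "point_of (side n) \<bullet> (point_of (vert m n l) - point_of (vert l m n)) = 0"
        using perp[of n l m] cc by (simp add: inner_diff_right)
      have "0 < point_of (side m) \<bullet> (point_of (vert n l m) - point_of (vert m n l))"
        using out[of m n l] cc that(4-6) by simp
      moreover have "0 < point_of (side n) \<bullet> (point_of (vert l m n) - point_of (vert n l m))"
        using out[of n l m] cc that(4-6) by simp
      ultimately show "0 < (point_of (side m) \<bullet> (point_of (vert m n l) - point_of (vert l m n)))
          * (point_of (side n) \<bullet> (point_of (vert n l m) - point_of (vert l m n)))"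
        using perp[of m n l] perp[of n l m] cc by (simp add: inner_diff_right mult_neg_neg)
    qed
    also have "\<dots> = - Re (m * cnj n)"
      unfolding dot norm_point_of side_def using that(1-3) by (simp add: norm_mult)
    finally show ?thesis .
  qed
  have "cosine_triple (point_of u, point_of v, point_of w) = (x, y, z)"
    unfolding cosine_triple_def u_def v_def w_def
    using cos[OF n crosses(3,1,2)] cos[OF n(2,3,1) crosses(1,2,3)] cos[OF n(3,1,2) crosses(2,3,1)] dots
    by simp
  with sp show thesis by (rule that)
qed

text \<open>Here the stretched triangle shall have the prescribed normals. Since \<open>side_normal\<close> is a diagonal map,
  the vertices before the stretching are obtained by inverting it on suitable multiples of the normals. The
  normalised sum of squares makes these vectors unit vectors and conjugate to each other.\<close>

lemma self_polar_with_stretched_cosines: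
  assumes ab: "a > 0" "b > 0" and pos: "x > 0" "y > 0" "z > 0"
    and id: "x\<^sup>2 + y\<^sup>2 + z\<^sup>2 + 2 * (x * y * z) = 1" and k: "x * y * z = a * b / (2 * (a + b)\<^sup>2)"
  obtains p q r where "self_polar a b p q r"
    "cosine_triple (stretch a b p, stretch a b q, stretch a b r) = (x, y, z)"
proof -
  define \<rho> where "\<rho> = a + b"
  have \<rho>: "\<rho> > 0" using ab unfolding \<rho>_def by simp
  define f where f: "f = (a - b) / (a + b)"
  have "f\<^sup>2 = 1 - 8 * (x * y * z)"
    unfolding k f using ab by (intro ratio_square) simp
  from exists_side_normals[OF pos id this] obtain n1 n2 n3 where
    n: "cmod n1 = 1" "cmod n2 = 1" "cmod n3 = 1"
    and dots: "Re (n2 * cnj n3) = - x" "Re (n3 * cnj n1) = - y" "Re (n1 * cnj n2) = - z"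
    and crosses: "0 < Im (cnj n2 * n3)" "0 < Im (cnj n3 * n1)" "0 < Im (cnj n1 * n2)"
    and sum: "n1\<^sup>2 + n2\<^sup>2 + n3\<^sup>2 = of_real f" by blast
  (* up to the length, side_normal (vert l m n) is l: A and B undo the two weights of side_normal,
     and the denominator contains the sine of the angle at the vertex, which makes vert a unit vector *)
  define A B where "A = sqrt (a * (a + 2 * b))" and "B = sqrt (b * (2 * a + b))"
  have AB: "A\<^sup>2 = a * (a + 2 * b)" "B\<^sup>2 = b * (2 * a + b)" using ab unfolding A_def B_def by simp_all
  define C where "C = sqrt ((2 * a + b) * (a + 2 * b))"
  have C: "C > 0" using ab unfolding C_def by simp
  define vert where "vert = (\<lambda>l m n :: complex. (1 / (\<rho> * Im (cnj m * n))) *\<^sub>R (A * Re l, B * Im l))"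
  have unit: "(Re l)\<^sup>2 + (Im l)\<^sup>2 = 1" if "cmod l = 1" for l
    using that by (metis cmod_power2 one_power2)
  (* the complex equation for the sum of the squares says that the matrix of second moments of the
     three unit normals is diagonal, with the entries given here; frame is invariant under rotating
     the three arguments, so that each fact about one vertex or side holds for all three *)
  define frame where "frame = (\<lambda>l m n :: complex.
    cmod l = 1 \<and> cmod m = 1 \<and> cmod n = 1 \<and> 0 < Im (cnj m * n) \<and> 0 < Im (cnj n * l) \<and> 0 < Im (cnj l * m)
    \<and> \<rho> * ((Re l)\<^sup>2 + (Re m)\<^sup>2 + (Re n)\<^sup>2) = 2 * a + b \<and> \<rho> * ((Im l)\<^sup>2 + (Im m)\<^sup>2 + (Im n)\<^sup>2) = a + 2 * b
    \<and> Re l * Im l + Re m * Im m + Re n * Im n = 0)"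
  have fr: "frame n1 n2 n3"
  proof -
    have "Re (n1\<^sup>2 + n2\<^sup>2 + n3\<^sup>2) = f" "Im (n1\<^sup>2 + n2\<^sup>2 + n3\<^sup>2) = 0" unfolding sum by simp_all
    then have d: "(Re n1)\<^sup>2 + (Re n2)\<^sup>2 + (Re n3)\<^sup>2 - ((Im n1)\<^sup>2 + (Im n2)\<^sup>2 + (Im n3)\<^sup>2) = f"
      and "2 * (Re n1 * Im n1 + Re n2 * Im n2 + Re n3 * Im n3) = 0"
      by (simp_all add: power2_eq_square algebra_simps)
    then have e: "Re n1 * Im n1 + Re n2 * Im n2 + Re n3 * Im n3 = 0" by simp
    have s: "(Re n1)\<^sup>2 + (Re n2)\<^sup>2 + (Re n3)\<^sup>2 + ((Im n1)\<^sup>2 + (Im n2)\<^sup>2 + (Im n3)\<^sup>2) = 3"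
      using n[THEN unit] by simp
    have \<rho>f: "\<rho> * f = a - b" unfolding f \<rho>_def using ab by simp
    have r: "(Re n1)\<^sup>2 + (Re n2)\<^sup>2 + (Re n3)\<^sup>2 = (3 + f) / 2" and i: "(Im n1)\<^sup>2 + (Im n2)\<^sup>2 + (Im n3)\<^sup>2 = (3 - f) / 2"
      using d s by simp_all
    have "\<rho> * ((3 + f) / 2) = 2 * a + b" "\<rho> * ((3 - f) / 2) = a + 2 * b"
      using \<rho>f by (simp_all add: algebra_simps \<rho>_def)
    then show ?thesis unfolding frame_def r i using n crosses e by blast
  qed
  have rot: "frame m n l" if "frame l m n" for l m n
    using that unfolding frame_def by (simp add: add_ac)
  have vunit: "vert l m n \<in> sphere 0 1" if "frame l m n" for l m n
  proof -
    define S where "S = Im (cnj m * n)"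
    have S: "S > 0" using that unfolding S_def frame_def by blast
    (* Lagrange's identity, with the last line vanishing by the frame condition *)
    have "(\<rho> * S)\<^sup>2 = (\<rho> * ((Re l)\<^sup>2 + (Re m)\<^sup>2 + (Re n)\<^sup>2)) * (\<rho> * ((Im l)\<^sup>2 + (Im m)\<^sup>2 + (Im n)\<^sup>2))
        - \<rho> * (Re l)\<^sup>2 * (\<rho> * ((Im l)\<^sup>2 + (Im m)\<^sup>2 + (Im n)\<^sup>2)) - \<rho> * (Im l)\<^sup>2 * (\<rho> * ((Re l)\<^sup>2 + (Re m)\<^sup>2 + (Re n)\<^sup>2))
        - \<rho>\<^sup>2 * (Re l * Im l + Re m * Im m + Re n * Im n) * (Re m * Im m + Re n * Im n - Re l * Im l)"
      unfolding S_def by (simp add: power2_eq_square algebra_simps)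
    also have "\<dots> = (2 * a + b) * (a + 2 * b) - \<rho> * (Re l)\<^sup>2 * (a + 2 * b) - \<rho> * (Im l)\<^sup>2 * (2 * a + b)"
      using that unfolding frame_def by simp
    also have "\<dots> = A\<^sup>2 * (Re l)\<^sup>2 + B\<^sup>2 * (Im l)\<^sup>2"
      using unit[of l] that unfolding AB frame_def \<rho>_def by algebra
    finally have "(A * Re l / (\<rho> * S))\<^sup>2 + (B * Im l / (\<rho> * S))\<^sup>2 = (\<rho> * S)\<^sup>2 / (\<rho> * S)\<^sup>2"
      by (simp only: power_divide power_mult_distrib add_divide_distrib)
    also have "\<dots> = 1" using \<rho> S by simp
    finally show ?thesis unfolding unit_point vert_def S_def[symmetric] by simp
  qed
  have vconj: "conjugate_points a b (vert l m n) (vert m n l)" if "frame l m n" for l m n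
  proof -
    define S T where "S = Im (cnj m * n)" and "T = Im (cnj n * l)"
    have ST: "S > 0" "T > 0" using that unfolding S_def T_def frame_def by blast+
    have "- (\<rho> * (S * T)) = Re l * Re m * (\<rho> * ((Im l)\<^sup>2 + (Im m)\<^sup>2 + (Im n)\<^sup>2))
        + Im l * Im m * (\<rho> * ((Re l)\<^sup>2 + (Re m)\<^sup>2 + (Re n)\<^sup>2))
        - \<rho> * (Re l * Im m + Im l * Re m) * (Re l * Im l + Re m * Im m + Re n * Im n)"
      unfolding S_def T_def by (simp add: power2_eq_square algebra_simps)
    also have "\<dots> = Re l * Re m * (a + 2 * b) + Im l * Im m * (2 * a + b)"
      using that unfolding frame_def by simp
    also have "\<dots> = (A\<^sup>2 * (Re l * Re m)) / a + (B\<^sup>2 * (Im l * Im m)) / b"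
      unfolding AB using ab by simp
    finally have e: "(A\<^sup>2 * (Re l * Re m)) / a + (B\<^sup>2 * (Im l * Im m)) / b = - (\<rho> * (S * T))" ..
    have "fst (vert l m n) * fst (vert m n l) / a + snd (vert l m n) * snd (vert m n l) / b
      = ((A\<^sup>2 * (Re l * Re m)) / a + (B\<^sup>2 * (Im l * Im m)) / b) / (\<rho> * S * (\<rho> * T))"
      unfolding vert_def S_def[symmetric] T_def[symmetric]
      by (simp add: add_divide_distrib power2_eq_square mult_ac)
    also have "\<dots> = - 1 / \<rho>" unfolding e using \<rho> ST by simp
    finally show ?thesis unfolding conjugate_points_def \<rho>_def .
  qed
  have vnormal: "side_normal a b (vert l m n) = (C / (\<rho> * Im (cnj m * n))) *\<^sub>R point_of l" for l m n
  proof -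
    have "sqrt ((2 * a + b) / a) * A = C" "sqrt ((2 * b + a) / b) * B = C"
      unfolding A_def B_def C_def real_sqrt_mult[symmetric] using ab by (simp_all add: add.commute mult.commute)
    then show ?thesis unfolding side_normal_def vert_def point_of_def
      by (simp add: mult.assoc[symmetric])
  qed
  have vcos: "cos (internal_angle (stretch a b (vert n l m)) (stretch a b (vert l m n)) (stretch a b (vert m n l)))
     = - Re (m * cnj n)" if fr: "frame l m n" for l m n
  proof -
    note c = vconj[OF fr] vconj[OF rot[OF fr]] vconj[OF rot[OF rot[OF fr]]]
    have c': "conjugate_points a b (vert m n l) (vert l m n)" "conjugate_points a b (vert n l m) (vert m n l)"
      using c unfolding conjugate_points_def by (simp_all add: mult.commute)
    define \<alpha> \<beta> where "\<alpha> = C / (\<rho> * Im (cnj n * l))" and "\<beta> = C / (\<rho> * Im (cnj l * m))"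
    have p: "\<alpha> > 0" "\<beta> > 0" using fr \<rho> C unfolding \<alpha>_def \<beta>_def frame_def by simp_all
    have "cos (internal_angle (stretch a b (vert n l m)) (stretch a b (vert l m n)) (stretch a b (vert m n l)))
      = - ((\<alpha> *\<^sub>R point_of m) \<bullet> (\<beta> *\<^sub>R point_of n)) / (norm (\<alpha> *\<^sub>R point_of m) * norm (\<beta> *\<^sub>R point_of n))"
      unfolding cos_stretched_angle[OF ab c(3) c'(1) c'(2)] vnormal \<alpha>_def \<beta>_def ..
    also have "\<dots> = - (point_of m \<bullet> point_of n)"
      using p fr unfolding frame_def by (simp add: norm_point_of)
    finally show ?thesis unfolding point_of_def by simp
  qed
  show thesis
  proof
    show "self_polar a b (vert n1 n2 n3) (vert n2 n3 n1) (vert n3 n1 n2)"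
      unfolding self_polar_def using fr rot vunit vconj by (simp del: mem_sphere_0)
    show "cosine_triple (stretch a b (vert n1 n2 n3), stretch a b (vert n2 n3 n1), stretch a b (vert n3 n1 n2)) = (x, y, z)"
      unfolding cosine_triple_def
      using vcos[OF fr] vcos[OF rot[OF fr]] vcos[OF rot[OF rot[OF fr]]] dots by simp
  qed
qed

section \<open>The locus\<close>

theorem theorem2:
  fixes a b k' s' :: real
    and K X :: "triangle set"
    and \<Delta>' :: "(real \<times> real \<times> real) set"
  assumes "a \<ge> b" and "b > 0"
    and "k' = a * b / (2 * (a + b)^2)"
    and "s' = sqrt ((2 * b^2 + a * b) / (2 * a^2 + a * b))"
    and "K = circumcircle_family a b"
    and "X = map_triangle (\<lambda>(x, y). (s' * x, y)) ` K"
    and "\<Delta>' = {(x, y, z). x^2 + y^2 + z^2 + 2 * k' - 1 = 0 \<and> x * y * z - k' = 0}"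
  shows "(0 < 1 - 2 * k' \<and> \<Delta>' = sphere 0 (sqrt (1 - 2 * k')) \<inter> titeica_surface k')
    \<and> cosine_locus K = \<Delta>' \<inter> positive_octant
    \<and> cosine_locus X = \<Delta>' \<inter> positive_octant"
proof -
  have ab: "a > 0" "b > 0" using assms(1,2) by simp_all
  have \<rho>: "a + b > 0" using ab by simp
  have k0: "k' > 0" unfolding assms(3) using ab by simp
  have k1: "0 < 1 - 2 * k'"
  proof -
    have "a * b < (a + b)\<^sup>2" using ab by (simp add: power2_eq_square algebra_simps add_pos_pos)
    then show ?thesis unfolding assms(3) using \<rho> by simp
  qed
  have sphere: "\<Delta>' = sphere 0 (sqrt (1 - 2 * k')) \<inter> titeica_surface k'"
  proof -
    have "(x, y, z) \<in> sphere 0 (sqrt (1 - 2 * k')) \<longleftrightarrow> x\<^sup>2 + y\<^sup>2 + z\<^sup>2 + 2 * k' - 1 = 0" for x y z :: real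
      by (auto simp: norm_prod_def add.assoc)
    then show ?thesis unfolding assms(7) titeica_surface_def by auto
  qed
  have mem: "cosine_triple (P, Q, R) \<in> \<Delta>' \<inter> positive_octant"
    if "P \<noteq> Q" "Q \<noteq> R" "R \<noteq> P"
      "\<And>x y z. cosine_triple (P, Q, R) = (x, y, z) \<Longrightarrow> x * y * z = k'" for P Q R
  proof -
    obtain x y z where c: "cosine_triple (P, Q, R) = (x, y, z)" by (metis prod.exhaust)
    show ?thesis
      using cosine_product_characterises[OF that(1-3) c that(4)[OF c] k0]
      unfolding c assms(7) positive_octant_def by simp
  qed
  have target: "0 < x \<and> 0 < y \<and> 0 < z \<and> x\<^sup>2 + y\<^sup>2 + z\<^sup>2 + 2 * (x * y * z) = 1 \<and> x * y * z = a * b / (2 * (a + b)\<^sup>2)"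
    if "(x, y, z) \<in> \<Delta>' \<inter> positive_octant" for x y z
    using that unfolding assms(7) positive_octant_def by (simp add: assms(3)[symmetric])
  have K: "K = (\<lambda>(p, q, r). ((a + b) *\<^sub>R p, (a + b) *\<^sub>R q, (a + b) *\<^sub>R r)) ` {(p, q, r). self_polar a b p q r}"
    unfolding assms(5) by (rule circumcircle_family_self_polar[OF ab])
  have locK: "cosine_locus K = (\<lambda>(p, q, r). cosine_triple (p, q, r)) ` {(p, q, r). self_polar a b p q r}"
    unfolding K cosine_locus_def image_image
    by (rule image_cong[OF refl], clarify) (simp only: prod.case cosine_triple_scaleR[OF \<rho>])
  have str: "(\<lambda>(x, y). (s' * x, y)) = stretch a b" unfolding stretch_def assms(4) ..
  have locX: "cosine_locus X
    = (\<lambda>(p, q, r). cosine_triple (stretch a b p, stretch a b q, stretch a b r)) ` {(p, q, r). self_polar a b p q r}"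
    unfolding assms(6) K str cosine_locus_def image_image map_triangle_def
    by (rule image_cong[OF refl], clarify)
      (simp only: prod.case linear_stretch cosine_triple_scaleR[OF \<rho>])
  have "cosine_locus K = \<Delta>' \<inter> positive_octant"
  proof (intro equalityI subsetI)
    fix t assume "t \<in> cosine_locus K"
    then obtain p q r where sp: "self_polar a b p q r" and t: "t = cosine_triple (p, q, r)"
      unfolding locK by auto
    show "t \<in> \<Delta>' \<inter> positive_octant"
      unfolding t assms(3)
      by (intro mem self_polar_distinct[OF ab sp]) (simp add: self_polar_cosine_product[OF ab sp] assms(3))
  next
    fix t assume t: "t \<in> \<Delta>' \<inter> positive_octant"
    obtain x y z where xyz: "t = (x, y, z)" by (metis prod.exhaust)
    from target[OF t[unfolded xyz]] self_polar_with_cosines[OF ab, of x y z]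
    obtain p q r where "self_polar a b p q r" "cosine_triple (p, q, r) = (x, y, z)" by metis
    then show "t \<in> cosine_locus K" unfolding locK xyz
      by (intro image_eqI[of _ _ "(p, q, r)"]) simp_all
  qed
  moreover have "cosine_locus X = \<Delta>' \<inter> positive_octant"
  proof (intro equalityI subsetI)
    fix t assume "t \<in> cosine_locus X"
    then obtain p q r where sp: "self_polar a b p q r"
      and t: "t = cosine_triple (stretch a b p, stretch a b q, stretch a b r)"
      unfolding locX by auto
    have "stretch a b p \<noteq> stretch a b q" "stretch a b q \<noteq> stretch a b r" "stretch a b r \<noteq> stretch a b p"
      using stretch_injective[OF ab] self_polar_distinct[OF ab sp] by blast+
    then show "t \<in> \<Delta>' \<inter> positive_octant"
      unfolding t by (intro mem) (simp_all add: stretched_self_polar_cosine_product[OF ab sp] assms(3))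
  next
    fix t assume t: "t \<in> \<Delta>' \<inter> positive_octant"
    obtain x y z where xyz: "t = (x, y, z)" by (metis prod.exhaust)
    from target[OF t[unfolded xyz]] self_polar_with_stretched_cosines[OF ab, of x y z]
    obtain p q r where "self_polar a b p q r"
      "cosine_triple (stretch a b p, stretch a b q, stretch a b r) = (x, y, z)" by metis
    then show "t \<in> cosine_locus X" unfolding locX xyz
      by (intro image_eqI[of _ _ "(p, q, r)"]) simp_all
  qed
  ultimately show ?thesis using k1 sphere by blast
qed

end
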